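(* For $i=1,2$ let $G_i$ be an $r_i$-regular graph with $n_i\ge 2$ vertices and $m_i$ edges (for $G_1$), and let $0=\tilde{\mu}_1(G_i)\le\dots\le\tilde{\mu}_{n_i}(G_i)$ be the normalized Laplacian eigenvalues of $G_i$. Then the normalized Laplacian characteristic polynomial $f(\mathcal{L}(G_1\veebar G_2),x)=\det\big(xI-\mathcal{L}(G_1\veebar G_2)\big)$ of the central edge join equals $$(x-1)^{m_1-n_1-1}\prod_{i=2}^{n_2}\left(x-\frac{m_1}{r_2+m_1}-\frac{r_2}{r_2+m_1}\tilde{\mu}_i(G_2)\right)\prod_{i=2}^{n_1}\left[(x-1)^2+\frac{\big(-1-r_1+r_1\tilde{\mu}_i(G_1)\big)(x-1)}{n_1-1}-\frac{2r_1-r_1\tilde{\mu}_i(G_1)}{(n_1-1)(n_2+2)}\right]$$ $$\times\left[\Big((x-1)^2+\frac{(n_1-1-r_1)(x-1)}{n_1-1}-\frac{2r_1}{(n_1-1)(n_2+2)}\Big)\Big(\big(x-\tfrac{m_1}{r_2+m_1}\big)(x-1)-\frac{n_2m_1}{(n_2+2)(r_2+m_1)}\Big)-\frac{n_2r_1^2n_1}{(n_1-1)(n_2+2)^2(r_2+m_1)}\right].$$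
   Context: All graphs are finite, simple and undirected. The central graph $C(G)$ of a graph $G$ is obtained by subdividing each edge of $G$ exactly once (the new vertices are the vertices corresponding to edges of $G$) and joining every pair of vertices of $G$ that are non-adjacent in $G$. The central edge join $G_1\veebar G_2$ of $G_1$ (with $n_1$ vertices, $m_1$ edges) and $G_2$ (with $n_2$ vertices) is obtained from the disjoint union of $C(G_1)$ and $G_2$ by joining each vertex of $C(G_1)$ corresponding to an edge of $G_1$ with every vertex of $G_2$; it has $m_1+n_1+n_2$ vertices. For a graph $H$, the normalized Laplacian $\mathcal{L}(H)$ has $(i,j)$ entry $1$ if $i=j$ and $d_i\ne 0$, $-1/\sqrt{d_id_j}$ if $v_i\sim v_j$, and $0$ otherwise. *)

theory Defs
  imports
    "Graph_Theory.Pair_Digraph"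
    "Jordan_Normal_Form.Char_Poly"
    "HOL-Computational_Algebra.Polynomial_Factorial"
begin

text \<open>
  A finite simple undirected graph is a \<^locale>\<open>pair_graph\<close>: a finite, symmetric, loop-free digraph
  without parallel arcs. An undirected edge is thus a pair of opposite arcs, and the degree of a
  vertex is its \<^const>\<open>out_degree\<close>.
\<close>

definition edge_set :: "'a pair_pre_digraph \<Rightarrow> 'a set set" where
  "edge_set G = (\<lambda>(u, v). {u, v}) ` parcs G"

definition vertex_degree :: "'a pair_pre_digraph \<Rightarrow> 'a \<Rightarrow> nat" where
  "vertex_degree G v = out_degree (with_proj G) v"

definition regular_graph :: "'a pair_pre_digraph \<Rightarrow> nat \<Rightarrow> bool" where
  "regular_graph G r \<longleftrightarrow> pair_graph G \<and> (\<forall>v \<in> pverts G. vertex_degree G v = r)"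

text \<open>\<open>Inl v\<close> is the original vertex \<open>v\<close>, and \<open>Inr e\<close> the vertex subdividing the edge \<open>e\<close>.\<close>

definition central_graph :: "'a pair_pre_digraph \<Rightarrow> ('a + 'a set) pair_pre_digraph" where
  "central_graph G = \<lparr>
     pverts = pverts G <+> edge_set G,
     parcs =
       {(Inl u, Inr e) |u e. e \<in> edge_set G \<and> u \<in> e} \<union>
       {(Inr e, Inl u) |u e. e \<in> edge_set G \<and> u \<in> e} \<union>
       {(Inl u, Inl v) |u v. u \<in> pverts G \<and> v \<in> pverts G \<and> u \<noteq> v \<and> (u, v) \<notin> parcs G} \<rparr>"

definition central_edge_join ::
    "'a pair_pre_digraph \<Rightarrow> 'b pair_pre_digraph \<Rightarrow> (('a + 'a set) + 'b) pair_pre_digraph" where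
  "central_edge_join G\<^sub>1 G\<^sub>2 = \<lparr>
     pverts = pverts (central_graph G\<^sub>1) <+> pverts G\<^sub>2,
     parcs =
       {(Inl p, Inl q) |p q. (p, q) \<in> parcs (central_graph G\<^sub>1)} \<union>
       {(Inr u, Inr v) |u v. (u, v) \<in> parcs G\<^sub>2} \<union>
       {(Inl (Inr e), Inr v) |e v. e \<in> edge_set G\<^sub>1 \<and> v \<in> pverts G\<^sub>2} \<union>
       {(Inr v, Inl (Inr e)) |e v. e \<in> edge_set G\<^sub>1 \<and> v \<in> pverts G\<^sub>2} \<rparr>"

definition vertex_enum :: "'a pair_pre_digraph \<Rightarrow> 'a list \<Rightarrow> bool" where
  "vertex_enum G vs \<longleftrightarrow> distinct vs \<and> set vs = pverts G"

text \<open>Rows and columns are indexed by the positions in an enumeration \<open>vs\<close> of the vertices.\<close>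

definition normalized_laplacian :: "'a pair_pre_digraph \<Rightarrow> 'a list \<Rightarrow> real mat" where
  "normalized_laplacian G vs = mat (length vs) (length vs) (\<lambda>(i, j).
     if i = j \<and> vertex_degree G (vs ! i) \<noteq> 0 then 1
     else if (vs ! i, vs ! j) \<in> parcs G
       then - 1 / sqrt (real (vertex_degree G (vs ! i)) * real (vertex_degree G (vs ! j)))
     else 0)"

text \<open>
  \<open>\<mu> 1 \<le> \<dots> \<le> \<mu> n\<close> are the eigenvalues of the matrix, repeated according to their algebraic
  multiplicity (only the values of \<open>\<mu>\<close> on \<open>{1..n}\<close> matter).
\<close>

definition ordered_eigenvalues :: "real mat \<Rightarrow> (nat \<Rightarrow> real) \<Rightarrow> bool" where
  "ordered_eigenvalues A \<mu> \<longleftrightarrow>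
     mono_on {1..dim_row A} \<mu> \<and> char_poly A = (\<Prod>i = 1..dim_row A. [:- \<mu> i, 1:])"

lemma finite_edge_set: "pair_graph G \<Longrightarrow> finite (edge_set G)"
  by (simp add: edge_set_def pair_graph_def pair_digraph_def pair_fin_digraph.pair_finite_arcs)

lemma edge_set_subset: "pair_graph G \<Longrightarrow> e \<in> edge_set G \<Longrightarrow> e \<subseteq> pverts G"
  by (auto simp: edge_set_def pair_graph_def pair_digraph_def pair_fin_digraph_def
      dest: pair_wf_digraph.in_arcsD1 pair_wf_digraph.in_arcsD2)

lemma pair_graphI:
  assumes "finite (pverts G)" and "parcs G \<subseteq> pverts G \<times> pverts G"
    and "sym (parcs G)" and "irrefl (parcs G)"
  shows "pair_graph G"
proof -
  have "finite (parcs G)"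
    using assms(1,2) by (meson finite_SigmaI finite_subset)
  then show ?thesis
    using assms by unfold_locales (auto simp: symmetric_def irrefl_def)
qed

lemma pair_graphD:
  assumes "pair_graph G"
  shows "finite (pverts G)" and "parcs G \<subseteq> pverts G \<times> pverts G"
    and "sym (parcs G)" and "irrefl (parcs G)"
proof -
  interpret pair_graph G by fact
  show "finite (pverts G)" "parcs G \<subseteq> pverts G \<times> pverts G" "sym (parcs G)" "irrefl (parcs G)"
    using pair_sym_arcs by (auto simp: symmetric_def irrefl_def dest: wellformed' pair_no_loops)
qed

lemma central_graph_pverts: "pverts (central_graph G) = pverts G <+> edge_set G"
  by (simp add: central_graph_def)

lemma pair_graph_central_graph:
  assumes "pair_graph G"
  shows "pair_graph (central_graph G)"
  using pair_graphD[OF assms] finite_edge_set[OF assms]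
  by (intro pair_graphI)
     (auto simp: central_graph_def sym_def irrefl_def dest: subsetD[OF edge_set_subset[OF assms]])

lemma pair_graph_central_edge_join:
  assumes "pair_graph G\<^sub>1" and "pair_graph G\<^sub>2"
  shows "pair_graph (central_edge_join G\<^sub>1 G\<^sub>2)"
  using pair_graphD[OF pair_graph_central_graph[OF assms(1)]] pair_graphD[OF assms(2)]
  by (intro pair_graphI)
     (auto simp: central_edge_join_def sym_def irrefl_def central_graph_pverts)

end

theory Submission
  imports Defs
begin

text \<open>
  Order the vertices of the join as edges of \<open>G\<^sub>1\<close>, vertices of \<open>G\<^sub>1\<close>, vertices of \<open>G\<^sub>2\<close> and
  evaluate the characteristic polynomial at a real \<open>t\<close>. The edge block is \<open>(t - 1) I\<close>. The incidence
  matrix \<open>R\<close> of \<open>G\<^sub>1\<close> satisfies \<open>R R\<^sup>T = A\<^sub>1 + r\<^sub>1 I\<close> and has constant row sums, so the Schur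
  complement of that block has diagonal blocks \<open>a I + b A\<^sub>i + c J\<close>, where \<open>J\<close> is the all-ones matrix,
  and constant off-diagonal blocks. A second Schur complement decouples the two graphs, because the
  all-ones vector is an eigenvector of every such block. The determinant of \<open>a I + b A\<close> for a regular
  graph is read off its normalized Laplacian spectrum, and adding \<open>c J\<close> only changes the factor
  belonging to the eigenvalue \<open>0\<close>. The complements exist for all but finitely many \<open>t\<close>, which suffices
  for a polynomial identity.
\<close>

section \<open>Determinants of matrices indexed by labels: reordering, Schur complements, constant
  updates\<close>

text \<open>Entries depend on labels and not on positions, so reordering the list permutes rows and
  columns simultaneously and appending lists produces a block matrix.\<close>

definition matrix_on :: "'a list \<Rightarrow> ('a \<Rightarrow> 'a \<Rightarrow> 'b) \<Rightarrow> 'b mat" where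
  "matrix_on vs f = mat (length vs) (length vs) (\<lambda>(i, j). f (vs ! i) (vs ! j))"

lemma matrix_on_carrier [simp]: "matrix_on vs f \<in> carrier_mat (length vs) (length vs)"
  by (simp add: matrix_on_def)

lemma matrix_on_cong:
  assumes "\<And>u v. u \<in> set vs \<Longrightarrow> v \<in> set vs \<Longrightarrow> f u v = g u v"
  shows "matrix_on vs f = matrix_on vs g"
  using assms by (auto simp: matrix_on_def intro!: cong_mat)

lemma matrix_on_map: "matrix_on (map h vs) f = matrix_on vs (\<lambda>u v. f (h u) (h v))"
  by (auto simp: matrix_on_def intro!: cong_mat)

text \<open>Two distinct enumerations of one set differ by a permutation acting on rows and columns
  alike, so its sign enters twice and cancels.\<close>

lemma det_matrix_on_enum:
  fixes f :: "'a \<Rightarrow> 'a \<Rightarrow> 'b :: comm_ring_1"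
  assumes "distinct us" and "distinct vs" and "set us = set vs"
  shows "det (matrix_on us f) = det (matrix_on vs f)"
proof -
  define n where "n = length vs"
  have mset: "mset us = mset vs"
    using assms set_eq_iff_mset_eq_distinct by blast
  then obtain p where p: "p permutes {..<length vs}" and us: "permute_list p vs = us"
    by (rule mset_eq_permutation)
  have len: "length us = n"
    using mset mset_eq_length n_def by blast
  have p': "p permutes {0..<n}"
    using p by (simp add: n_def atLeast0LessThan)
  have nth: "us ! i = vs ! p i" if "i < n" for i
    using that us p by (auto simp: n_def permute_list_nth)
  have pn: "p i < n" if "i < n" for i
    using permutes_in_image[OF p', of i] that by simp
  \<comment> \<open>Only the columns are permuted here. \<open>det_permute_rows\<close> treats rows,
    so the columns are handled through the transpose.\<close>
  define B where "B = mat n n (\<lambda>(i, j). f (vs ! i) (vs ! p j))"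
  have B: "B \<in> carrier_mat n n"
    by (simp add: B_def)
  have "matrix_on us f = mat n n (\<lambda>(i, j). B $$ (p i, j))"
    by (auto simp: matrix_on_def len B_def nth pn intro!: cong_mat)
  then have "det (matrix_on us f) = signof p * det B"
    using det_permute_rows[OF B p'] by simp
  also have "det B = det (transpose_mat B)"
    using det_transpose[OF B] by simp
  also have "transpose_mat B = mat n n (\<lambda>(i, j). transpose_mat (matrix_on vs f) $$ (p i, j))"
    by (auto simp: matrix_on_def B_def n_def pn[unfolded n_def] intro!: cong_mat)
  also have "det \<dots> = signof p * det (transpose_mat (matrix_on vs f))"
    by (rule det_permute_rows[OF _ p']) (simp add: n_def)
  also have "det (transpose_mat (matrix_on vs f)) = det (matrix_on vs f)"
    by (rule det_transpose[OF matrix_on_carrier])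
  finally show ?thesis
    by (cases p rule: sign_cases) simp_all
qed

lemma sum_nth_eq_sum_set:
  assumes "distinct us"
  shows "(\<Sum>i\<in>{0..<length us}. g (us ! i)) = (\<Sum>u\<in>set us. g u)"
  using sum.reindex_bij_betw[OF bij_betw_nth[OF assms, of "{0..<length us}" "set us"], of g]
  by (simp add: atLeast0LessThan)
 
text \<open>Schur complement without an inverse: with \<open>D\<close> and \<open>B\<close> for the
  upper blocks, \<open>X\<close> is only required to solve \<open>D X = B\<close>. Right
  multiplication by a unit upper triangular matrix containing \<open>- X\<close> clears
  \<open>B\<close> and preserves the determinant, without any division.\<close>

lemma det_matrix_on_append:
  fixes f :: "'a \<Rightarrow> 'a \<Rightarrow> 'b :: idom"
  assumes "distinct us"
    and X: "\<And>u w. u \<in> set us \<Longrightarrow> w \<in> set ws \<Longrightarrow> (\<Sum>v\<in>set us. f u v * X v w) = f u w"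
  shows "det (matrix_on (us @ ws) f) =
    det (matrix_on us f) * det (matrix_on ws (\<lambda>u w. f u w - (\<Sum>v\<in>set us. f u v * X v w)))"
proof -
  define m n where "m = length us" and "n = length ws"
  define B where "B = mat m n (\<lambda>(i, j). f (us ! i) (ws ! j))"
  define C where "C = mat n m (\<lambda>(i, j). f (ws ! i) (us ! j))"
  define Y where "Y = mat m n (\<lambda>(i, j). - X (us ! i) (ws ! j))"
  define S where "S = matrix_on ws (\<lambda>u w. f u w - (\<Sum>v\<in>set us. f u v * X v w))"
  define E where "E = four_block_mat (1\<^sub>m m) Y (0\<^sub>m n m) (1\<^sub>m n)"
  have car: "matrix_on us f \<in> carrier_mat m m" "B \<in> carrier_mat m n" "C \<in> carrier_mat n m"
    "matrix_on ws f \<in> carrier_mat n n" "Y \<in> carrier_mat m n" "S \<in> carrier_mat n n"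
    by (auto simp: m_def n_def B_def C_def Y_def S_def)
  have split: "matrix_on (us @ ws) f = four_block_mat (matrix_on us f) B C (matrix_on ws f)"
    by (intro eq_matI) (auto simp: matrix_on_def B_def C_def m_def n_def nth_append)
  have DY: "matrix_on us f * Y + B = 0\<^sub>m m n"
  proof (intro eq_matI)
    fix i j assume ij: "i < dim_row (0\<^sub>m m n :: 'b mat)" "j < dim_col (0\<^sub>m m n :: 'b mat)"
    have "(matrix_on us f * Y) $$ (i, j) = - (\<Sum>k\<in>{0..<length us}. f (us ! i) (us ! k) * X (us ! k) (ws ! j))"
      using ij by (auto simp: matrix_on_def Y_def m_def n_def scalar_prod_def sum_negf)
    also have "\<dots> = - f (us ! i) (ws ! j)"
      using ij X[of "us ! i" "ws ! j"]
      by (simp add: sum_nth_eq_sum_set[OF assms(1), of "\<lambda>v. f (us ! i) v * X v (ws ! j)"] m_def n_def)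
    finally show "(matrix_on us f * Y + B) $$ (i, j) = 0\<^sub>m m n $$ (i, j)"
      using ij by (simp add: B_def)
  qed (use car in auto)
  have CY: "C * Y + matrix_on ws f = S"
  proof (intro eq_matI)
    fix i j assume ij: "i < dim_row S" "j < dim_col S"
    then have ij': "i < n" "j < n" using car by auto
    have "(C * Y) $$ (i, j) = - (\<Sum>k\<in>{0..<length us}. f (ws ! i) (us ! k) * X (us ! k) (ws ! j))"
      using ij' by (auto simp: C_def Y_def m_def n_def scalar_prod_def sum_negf)
    also have "\<dots> = - (\<Sum>v\<in>set us. f (ws ! i) v * X v (ws ! j))"
      by (simp add: sum_nth_eq_sum_set[OF assms(1), of "\<lambda>v. f (ws ! i) v * X v (ws ! j)"])
    finally show "(C * Y + matrix_on ws f) $$ (i, j) = S $$ (i, j)"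
      using ij' by (simp add: S_def matrix_on_def n_def)
  qed (use car in auto)
  have "matrix_on (us @ ws) f * E = four_block_mat (matrix_on us f * 1\<^sub>m m + B * 0\<^sub>m n m) (matrix_on us f * Y + B * 1\<^sub>m n)
      (C * 1\<^sub>m m + matrix_on ws f * 0\<^sub>m n m) (C * Y + matrix_on ws f * 1\<^sub>m n)"
    unfolding split E_def by (rule mult_four_block_mat) (use car in auto)
  also have "\<dots> = four_block_mat (matrix_on us f) (0\<^sub>m m n) C S"
    using car DY CY by simp
  finally have prod: "matrix_on (us @ ws) f * E = four_block_mat (matrix_on us f) (0\<^sub>m m n) C S" .
  have "det E = 1"
    unfolding E_def using car by (subst det_four_block_mat_lower_left_zero[where n = m and m = n]) auto
  then have "det (matrix_on (us @ ws) f) = det (matrix_on (us @ ws) f * E)"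
    by (subst det_mult[where n = "m + n"])
       (use matrix_on_carrier[of "us @ ws" f] in \<open>auto simp: E_def m_def n_def intro!: four_block_carrier_mat\<close>)
  also have "\<dots> = det (matrix_on us f) * det S"
    unfolding prod using car by (subst det_four_block_mat_upper_right_zero[where n = m and m = n]) auto
  finally show ?thesis by (simp add: S_def)
qed

text \<open>Since all rows of the first diagonal block sum to \<open>\<sigma>\<close>, the constant
  matrix with entry \<open>c / \<sigma>\<close> solves the linear system required of
  \<open>X\<close>. The complement then subtracts one and the same constant from every entry of the
  second block.\<close>

lemma det_matrix_on_append_const:
  fixes f :: "'a \<Rightarrow> 'a \<Rightarrow> 'b :: field"
  assumes "distinct us"
    and "\<And>u. u \<in> set us \<Longrightarrow> (\<Sum>v\<in>set us. f u v) = \<sigma>" and "\<sigma> \<noteq> 0"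
    and "\<And>u w. u \<in> set us \<Longrightarrow> w \<in> set ws \<Longrightarrow> f u w = c"
    and "\<And>u w. u \<in> set us \<Longrightarrow> w \<in> set ws \<Longrightarrow> f w u = d"
  shows "det (matrix_on (us @ ws) f) =
    det (matrix_on us f) * det (matrix_on ws (\<lambda>u w. f u w - of_nat (length us) * c * d / \<sigma>))"
proof -
  have "det (matrix_on (us @ ws) f) =
    det (matrix_on us f) * det (matrix_on ws (\<lambda>u w. f u w - (\<Sum>v\<in>set us. f u v * (c / \<sigma>))))"
  proof (rule det_matrix_on_append[OF assms(1)])
    fix u w assume "u \<in> set us" and "w \<in> set ws"
    then show "(\<Sum>v\<in>set us. f u v * (c / \<sigma>)) = f u w"
      unfolding sum_distrib_right[symmetric] using assms(2-4) by simp
  qed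
  also have "matrix_on ws (\<lambda>u w. f u w - (\<Sum>v\<in>set us. f u v * (c / \<sigma>))) =
      matrix_on ws (\<lambda>u w. f u w - of_nat (length us) * c * d / \<sigma>)"
  proof (rule matrix_on_cong)
    fix u w assume "u \<in> set ws" and "w \<in> set ws"
    then have "(\<Sum>v\<in>set us. f u v * (c / \<sigma>)) = (\<Sum>v\<in>set us. d * (c / \<sigma>))"
      by (intro sum.cong refl) (simp add: assms(5))
    then show "f u w - (\<Sum>v\<in>set us. f u v * (c / \<sigma>)) = f u w - of_nat (length us) * c * d / \<sigma>"
      using assms(1) by (simp add: distinct_card)
  qed
  finally show ?thesis .
qed

text \<open>
  Border the matrix by the row \<open>- c\<close> and the column \<open>1\<close> (with corner \<open>1\<close>, indexed by \<^const>\<open>None\<close>), and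
  take the Schur complement of either diagonal block.
\<close>

lemma det_matrix_on_add_const:
  fixes f :: "'a \<Rightarrow> 'a \<Rightarrow> 'b :: field"
  assumes "distinct vs"
    and "\<And>u. u \<in> set vs \<Longrightarrow> (\<Sum>v\<in>set vs. f u v) = \<sigma>" and "\<sigma> \<noteq> 0"
  shows "det (matrix_on vs (\<lambda>u v. f u v + c)) = det (matrix_on vs f) * (1 + of_nat (length vs) * c / \<sigma>)"
proof -
  define g where "g x y = (case (x, y) of (Some u, Some v) \<Rightarrow> f u v | (None, Some v) \<Rightarrow> - c | _ \<Rightarrow> 1)"
    for x y :: "'a option"
  have single: "det (matrix_on [a] h) = h a a" for a and h :: "'a option \<Rightarrow> 'a option \<Rightarrow> 'b"
    by (subst det_single) (auto simp: matrix_on_def)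
  have "det (matrix_on ([None] @ map Some vs) g) = det (matrix_on [None] g) *
      det (matrix_on (map Some vs) (\<lambda>u w. g u w - of_nat (length [None :: 'a option]) * (- c) * 1 / 1))"
    by (rule det_matrix_on_append_const) (auto simp: g_def)
  then have 1: "det (matrix_on ([None] @ map Some vs) g) = det (matrix_on vs (\<lambda>u v. f u v + c))"
    by (simp add: single matrix_on_map g_def)
  have "det (matrix_on (map Some vs @ [None]) g) = det (matrix_on (map Some vs) g) *
      det (matrix_on [None] (\<lambda>u w. g u w - of_nat (length (map Some vs)) * 1 * (- c) / \<sigma>))"
    using assms
    by (intro det_matrix_on_append_const) (auto simp: g_def distinct_map sum.reindex)
  then have 2: "det (matrix_on (map Some vs @ [None]) g) =
      det (matrix_on vs f) * (1 + of_nat (length vs) * c / \<sigma>)"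
    by (simp add: single matrix_on_map g_def)
  have "det (matrix_on ([None] @ map Some vs) g) = det (matrix_on (map Some vs @ [None]) g)"
    using assms(1) by (intro det_matrix_on_enum) (auto simp: distinct_map)
  with 1 2 show ?thesis by simp
qed

lemma det_matrix_on_mult:
  fixes f :: "'a \<Rightarrow> 'a \<Rightarrow> 'b :: comm_ring_1"
  shows "det (matrix_on vs (\<lambda>u v. c * f u v)) = c ^ length vs * det (matrix_on vs f)"
proof -
  have "matrix_on vs (\<lambda>u v. c * f u v) = c \<cdot>\<^sub>m matrix_on vs f"
    by (intro eq_matI) (auto simp: matrix_on_def)
  then show ?thesis
    by (simp add: matrix_on_def)
qed

lemma det_matrix_on_diag:
  fixes c :: "'b :: comm_ring_1"
  assumes "distinct vs"
  shows "det (matrix_on vs (\<lambda>u v. c * of_bool (u = v))) = c ^ length vs"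
proof -
  have "matrix_on vs (\<lambda>u v. of_bool (u = v)) = (1\<^sub>m (length vs) :: 'b mat)"
    using assms by (intro eq_matI) (auto simp: matrix_on_def nth_eq_iff_index_eq)
  then show ?thesis
    by (simp add: det_matrix_on_mult)
qed

lemma poly_char_poly_matrix_on:
  fixes f :: "'a \<Rightarrow> 'a \<Rightarrow> 'b :: field"
  assumes "distinct vs"
  shows "poly (char_poly (matrix_on vs f)) t = det (matrix_on vs (\<lambda>u v. t * of_bool (u = v) - f u v))"
proof -
  have "- char_matrix (matrix_on vs f) t = matrix_on vs (\<lambda>u v. t * of_bool (u = v) - f u v)"
    using assms
    by (intro eq_matI) (auto simp: matrix_on_def char_matrix_def nth_eq_iff_index_eq)
  then show ?thesis
    by (simp add: char_poly_matrix[OF matrix_on_carrier])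
qed

section \<open>Normalized Laplacian and adjacency matrix of a regular graph\<close>

text \<open>The definition tests equality of positions, the right-hand side equality of vertices;
  distinctness identifies the two tests.\<close>

lemma normalized_laplacian_eq_matrix_on:
  assumes "distinct vs"
  shows "normalized_laplacian G vs = matrix_on vs (\<lambda>u v.
     if u = v \<and> vertex_degree G u \<noteq> 0 then 1
     else if (u, v) \<in> parcs G then - 1 / sqrt (real (vertex_degree G u) * real (vertex_degree G v))
     else 0)"
  unfolding normalized_laplacian_def matrix_on_def
  using assms by (intro cong_mat) (auto simp: nth_eq_iff_index_eq)

lemma vertex_degree_eq_card: "vertex_degree G v = card {w. (v, w) \<in> parcs G}"
proof -
  have "out_arcs (with_proj G) v = Pair v ` {w. (v, w) \<in> parcs G}"
    by (auto simp: out_arcs_def)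
  then show ?thesis
    by (simp add: vertex_degree_def out_degree_def card_image inj_on_def)
qed

lemma regular_graph_card_nbrs:
  assumes "regular_graph G r" and "v \<in> pverts G"
  shows "card {w. (v, w) \<in> parcs G} = r"
  using assms by (simp add: regular_graph_def vertex_degree_eq_card)

text \<open>This is the eigenvector equation of the adjacency matrix for the all-ones vector, the
  source of the constant row sums used later.\<close>

lemma regular_graph_sum_adj:
  assumes "regular_graph G r" and "v \<in> pverts G"
  shows "(\<Sum>w\<in>pverts G. of_bool ((v, w) \<in> parcs G)) = (of_nat r :: 'b :: semiring_1)"
proof -
  have pg: "pair_graph G"
    using assms(1) by (simp add: regular_graph_def)
  have "(\<Sum>w\<in>pverts G. of_bool ((v, w) \<in> parcs G)) = (of_nat (card {w \<in> pverts G. (v, w) \<in> parcs G}) :: 'b)"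
    using pair_graphD(1)[OF pg] by (simp add: sum_of_bool_eq Collect_conj_eq Int_commute)
  also have "{w \<in> pverts G. (v, w) \<in> parcs G} = {w. (v, w) \<in> parcs G}"
    using pair_graphD(2)[OF pg] by auto
  finally show ?thesis
    using regular_graph_card_nbrs[OF assms] by simp
qed

lemma regular_graph_0_no_arcs:
  assumes "regular_graph G 0"
  shows "parcs G = {}"
proof -
  have pg: "pair_graph G"
    using assms by (simp add: regular_graph_def)
  have "(u, v) \<notin> parcs G" for u v
  proof
    assume a: "(u, v) \<in> parcs G"
    then have "u \<in> pverts G"
      using pair_graphD(2)[OF pg] by auto
    \<comment> \<open>\<open>card\<close> is 0 on infinite sets too, so finiteness is what turns
      degree 0 into an empty neighbourhood.\<close>
    moreover have "finite {w. (u, w) \<in> parcs G}"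
      using pair_graphD(1,2)[OF pg] by (elim finite_subset[rotated]) auto
    ultimately show False
      using regular_graph_card_nbrs[OF assms, of u] a by auto
  qed
  then show ?thesis by auto
qed

text \<open>With all degrees equal to \<open>r\<close> the square root is \<open>r\<close>, so the
  Laplacian is \<open>I - A / r\<close>. For \<open>r = 0\<close> its diagonal is 0 and not 1, hence
  the assumption \<open>r > 0\<close>.\<close>

lemma regular_graph_normalized_laplacian:
  assumes "regular_graph G r" and "r > 0" and "vertex_enum G vs"
  shows "normalized_laplacian G vs =
    matrix_on vs (\<lambda>u v. of_bool (u = v) - of_bool ((u, v) \<in> parcs G) / real r)"
proof -
  have "irrefl (parcs G)" "distinct vs" "set vs = pverts G"
    using assms by (auto simp: regular_graph_def vertex_enum_def dest: pair_graphD)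
  then show ?thesis
    using assms(1,2)
    by (auto simp: normalized_laplacian_eq_matrix_on regular_graph_def irrefl_def intro!: matrix_on_cong)
qed

lemma length_vertex_enum: "vertex_enum G vs \<Longrightarrow> length vs = card (pverts G)"
  by (metis distinct_card vertex_enum_def)

lemma dim_normalized_laplacian [simp]: "dim_row (normalized_laplacian G vs) = length vs"
  by (simp add: normalized_laplacian_def)

section \<open>Determinants of \<open>a I + b A + c J\<close> from the Laplacian spectrum\<close>

text \<open>For nonzero \<open>b r\<close>, the relation \<open>A = r (I - L)\<close> makes the
  matrix a multiple of \<open>k I - L\<close>, so its determinant is a scaled value of the
  characteristic polynomial of \<open>L\<close>.\<close>

lemma regular_graph_det_spectrum:
  assumes "regular_graph G r" and "vertex_enum G vs"
    and "ordered_eigenvalues (normalized_laplacian G vs) \<mu>"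
  shows "det (matrix_on vs (\<lambda>u v. a * of_bool (u = v) + b * of_bool ((u, v) \<in> parcs G))) =
    (\<Prod>i = 1..length vs. a + b * real r - b * real r * \<mu> i)"
proof (cases "b * real r = 0")
  case True
  \<comment> \<open>Either \<open>b = 0\<close>, or \<open>r = 0\<close> and there are no arcs. In
    both cases the matrix is \<open>a I\<close> and every factor on the right is
    \<open>a\<close>.\<close>
  then have "b * of_bool ((u, v) \<in> parcs G) = 0" for u v
    using regular_graph_0_no_arcs[of G] assms(1) by auto
  then have "matrix_on vs (\<lambda>u v. a * of_bool (u = v) + b * of_bool ((u, v) \<in> parcs G)) =
      matrix_on vs (\<lambda>u v. a * of_bool (u = v))"
    by (intro matrix_on_cong) simp
  moreover have "distinct vs"
    using assms(2) by (simp add: vertex_enum_def)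
  ultimately show ?thesis
    by (simp only: True det_matrix_on_diag prod_constant) simp
next
  case False
  \<comment> \<open>Chosen so that \<open>a I + b A = b r (k I - L)\<close>.\<close>
  define k where "k = (a + b * r) / (b * r)"
  have r: "r > 0" and d: "distinct vs"
    using False assms(2) by (auto simp: vertex_enum_def)
  have "matrix_on vs (\<lambda>u v. a * of_bool (u = v) + b * of_bool ((u, v) \<in> parcs G)) =
      matrix_on vs (\<lambda>u v. (b * r) *
        (k * of_bool (u = v) - (of_bool (u = v) - of_bool ((u, v) \<in> parcs G) / real r)))"
    using False by (intro matrix_on_cong) (auto simp: k_def field_simps)
  then have "det (matrix_on vs (\<lambda>u v. a * of_bool (u = v) + b * of_bool ((u, v) \<in> parcs G))) =
      (b * r) ^ length vs * poly (char_poly (normalized_laplacian G vs)) k"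
    by (simp only: det_matrix_on_mult poly_char_poly_matrix_on[OF d]
      regular_graph_normalized_laplacian[OF assms(1) r assms(2)])
  also have "\<dots> = (\<Prod>i = 1..length vs. (b * r) * (k - \<mu> i))"
    using assms(3) by (simp add: ordered_eigenvalues_def poly_prod prod.distrib)
  also have "\<dots> = (\<Prod>i = 1..length vs. a + b * real r - b * real r * \<mu> i)"
    using False by (intro prod.cong) (auto simp: k_def field_simps)
  finally show ?thesis .
qed

text \<open>\<open>A / r\<close> is row stochastic, so it does not increase the maximum norm, and
  its eigenvalue \<open>1 - k\<close> has modulus at most 1.\<close>

lemma regular_graph_eigenvalue_nonneg:
  assumes "regular_graph G r" and "r > 0" and "vertex_enum G vs"
    and "eigenvalue (normalized_laplacian G vs) k"
  shows "k \<ge> 0"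
proof -
  define n where "n = length vs"
  define A where "A i j = (of_bool ((vs ! i, vs ! j) \<in> parcs G) :: real)" for i j
  have d: "distinct vs" "set vs = pverts G"
    using assms(3) by (auto simp: vertex_enum_def)
  obtain x where x: "x \<in> carrier_vec n" "x \<noteq> 0\<^sub>v n"
    and eq: "normalized_laplacian G vs *\<^sub>v x = k \<cdot>\<^sub>v x"
    using assms(4) by (auto simp: eigenvalue_def eigenvector_def n_def)
  have rowsum: "(\<Sum>j<n. A i j) = r" if "i < n" for i
    using sum_nth_eq_sum_set[OF d(1), of "\<lambda>v. of_bool ((vs ! i, v) \<in> parcs G) :: real"]
      regular_graph_sum_adj[OF assms(1), of "vs ! i", where 'b = real] that nth_mem[of i vs]
    by (simp add: A_def n_def d atLeast0LessThan)
  have row: "x $ i - (\<Sum>j<n. A i j * x $ j) / r = k * x $ i" if i: "i < n" for i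
  proof -
    have "k * x $ i = (normalized_laplacian G vs *\<^sub>v x) $ i"
      using eq i x by simp
    also have "\<dots> = (\<Sum>j<n. (of_bool (i = j) - A i j / r) * x $ j)"
      using i x d(1)
      by (auto simp: regular_graph_normalized_laplacian[OF assms(1-3)] matrix_on_def n_def A_def
          scalar_prod_def atLeast0LessThan nth_eq_iff_index_eq intro!: sum.cong)
    also have "\<dots> = (\<Sum>j<n. of_bool (i = j) * x $ j) - (\<Sum>j<n. A i j * x $ j) / r"
      by (simp add: left_diff_distrib sum_subtractf sum_divide_distrib)
    also have "(\<Sum>j<n. of_bool (i = j) * x $ j) = x $ i"
      using i by simp
    finally show ?thesis by simp
  qed
  have n: "n > 0"
    using x by (metis carrier_vecD eq_vecI gr0I index_zero_vec(2) less_nat_zero_code)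
  \<comment> \<open>Evaluate the eigenvalue equation at a coordinate of maximal modulus.\<close>
  define M where "M = Max ((\<lambda>i. \<bar>x $ i\<bar>) ` {..<n})"
  have M: "\<bar>x $ i\<bar> \<le> M" if "i < n" for i
    using that by (auto simp: M_def)
  have "M \<in> (\<lambda>i. \<bar>x $ i\<bar>) ` {..<n}"
    unfolding M_def using n by (intro Max_in) auto
  then obtain i where i: "i < n" "M = \<bar>x $ i\<bar>" by auto
  have "M > 0"
  proof (rule ccontr)
    assume "\<not> M > 0"
    then have "x $ j = 0" if "j < n" for j
      using M[OF that] by auto
    then have "x = 0\<^sub>v n"
      using x(1) by (intro eq_vecI) auto
    with x(2) show False ..
  qed
  have "\<bar>\<Sum>j<n. A i j * x $ j\<bar> \<le> (\<Sum>j<n. \<bar>A i j * x $ j\<bar>)"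
    by (rule sum_abs)
  also have "\<dots> \<le> (\<Sum>j<n. A i j * M)"
    using M by (intro sum_mono) (auto simp: A_def)
  also have "\<dots> = r * M"
    using rowsum[OF i(1)] by (simp flip: sum_distrib_right)
  finally have le: "\<bar>\<Sum>j<n. A i j * x $ j\<bar> \<le> r * M" .
  have "(\<Sum>j<n. A i j * x $ j) = r * ((1 - k) * x $ i)"
    using row[OF i(1)] assms(2) by (simp add: field_simps)
  then have "r * (\<bar>1 - k\<bar> * M) \<le> r * M"
    using le i by (simp add: abs_mult)
  then have "\<bar>1 - k\<bar> \<le> 1"
    using assms(2) \<open>M > 0\<close> by (simp add: mult_le_cancel_left1 mult_le_cancel_right1)
  then show ?thesis by linarith
qed

text \<open>For positive \<open>r\<close> the all-ones vector lies in the kernel of the Laplacian,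
  so some \<open>\<mu> j\<close> is 0; nonnegativity and monotonicity pass this on to
  \<open>\<mu> 1\<close>. The factor \<open>r\<close> makes degree 0 trivial, and it is as
  \<open>r * \<mu> i\<close> that eigenvalues enter the determinants.\<close>

lemma regular_graph_least_eigenvalue:
  assumes "regular_graph G r" and "vertex_enum G vs" and "vs \<noteq> []"
    and "ordered_eigenvalues (normalized_laplacian G vs) \<mu>"
  shows "real r * \<mu> 1 = 0"
proof (cases "r = 0")
  case False
  define L where "L = normalized_laplacian G vs"
  define n where "n = length vs"
  have d: "distinct vs" "set vs = pverts G"
    using assms(2) by (auto simp: vertex_enum_def)
  have L: "L = matrix_on vs (\<lambda>u v. of_bool (u = v) - of_bool ((u, v) \<in> parcs G) / real r)"
    using regular_graph_normalized_laplacian[OF assms(1) _ assms(2)] False by (simp add: L_def)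
  have Lc: "L \<in> carrier_mat n n"
    by (simp add: L n_def)
  have root: "poly (char_poly L) t = (\<Prod>i = 1..n. t - \<mu> i)" for t
    using assms(4) by (simp add: ordered_eigenvalues_def L_def n_def poly_prod)
  have nonneg: "\<mu> i \<ge> 0" if "i \<in> {1..n}" for i
  proof -
    have "poly (char_poly L) (\<mu> i) = 0"
      using that unfolding root by (intro prod_zero) auto
    then show ?thesis
      using eigenvalue_root_char_poly[OF Lc] regular_graph_eigenvalue_nonneg[OF assms(1) _ assms(2)] False
      by (simp add: L_def)
  qed
  have "eigenvector L (vec n (\<lambda>_. 1)) 0"
    unfolding eigenvector_def
  proof (intro conjI eq_vecI)
    show "vec n (\<lambda>_. 1) \<noteq> (0\<^sub>v (dim_row L) :: real vec)"
      using assms(3) Lc by (auto simp: n_def vec_eq_iff)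
  next
    fix i assume "i < dim_vec (0 \<cdot>\<^sub>v vec n (\<lambda>_. 1) :: real vec)"
    then have i: "i < n" by simp
    have "(L *\<^sub>v vec n (\<lambda>_. 1)) $ i =
        (\<Sum>j\<in>{0..<length vs}. of_bool (vs ! i = vs ! j) - of_bool ((vs ! i, vs ! j) \<in> parcs G) / real r)"
      using i by (simp add: L matrix_on_def n_def scalar_prod_def)
    also have "\<dots> = (\<Sum>v\<in>set vs. of_bool (vs ! i = v) - of_bool ((vs ! i, v) \<in> parcs G) / real r)"
      by (rule sum_nth_eq_sum_set[OF d(1)])
    also have "\<dots> = (\<Sum>v\<in>set vs. of_bool (vs ! i = v)) - (\<Sum>v\<in>set vs. of_bool ((vs ! i, v) \<in> parcs G)) / real r"
      by (simp only: sum_subtractf sum_divide_distrib)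
    also have "\<dots> = 0"
      using i False regular_graph_sum_adj[OF assms(1), of "vs ! i", where 'b = real] nth_mem[of i vs]
      by (simp add: n_def flip: d(2))
    finally show "(L *\<^sub>v vec n (\<lambda>_. 1)) $ i = (0 \<cdot>\<^sub>v vec n (\<lambda>_. 1)) $ i"
      using i by simp
  qed (use Lc in auto)
  then have "(\<Prod>i = 1..n. 0 - \<mu> i) = 0"
    using eigenvalue_root_char_poly[OF Lc, of 0] root[of 0] unfolding eigenvalue_def by auto
  then obtain j where j: "j \<in> {1..n}" "\<mu> j = 0"
    by auto
  moreover have "mono_on {1..n} \<mu>"
    using assms(4) by (simp add: ordered_eigenvalues_def n_def)
  ultimately have "\<mu> 1 \<le> 0"
    using monotone_onD[of "{1..n}" "(\<le>)" "(\<le>)" \<mu> 1 j] by auto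
  with nonneg[of 1] j show ?thesis by simp
qed simp

text \<open>The common row sum \<open>a + b r\<close> of \<open>a I + b A\<close> is also the
  determinant factor belonging to \<open>\<mu> 1\<close>. Adding the constant \<open>c\<close> to
  all entries therefore replaces just this factor by the new row sum.\<close>

lemma regular_graph_det_spectrum_add_const:
  assumes "regular_graph G r" and "vertex_enum G vs" and "vs \<noteq> []"
    and "ordered_eigenvalues (normalized_laplacian G vs) \<mu>"
    and "a + b * real r \<noteq> 0"
  shows "det (matrix_on vs (\<lambda>u v. a * of_bool (u = v) + b * of_bool ((u, v) \<in> parcs G) + c)) =
    (a + b * real r + real (length vs) * c) * (\<Prod>i = 2..length vs. a + b * real r - b * real r * \<mu> i)"
proof -
  have d: "distinct vs" "set vs = pverts G"
    using assms(2) by (auto simp: vertex_enum_def)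
  define P where "P = (\<Prod>i = 2..length vs. a + b * real r - b * real r * \<mu> i)"
  have "det (matrix_on vs (\<lambda>u v. a * of_bool (u = v) + b * of_bool ((u, v) \<in> parcs G) + c)) =
      det (matrix_on vs (\<lambda>u v. a * of_bool (u = v) + b * of_bool ((u, v) \<in> parcs G))) *
      (1 + of_nat (length vs) * c / (a + b * real r))"
  proof (rule det_matrix_on_add_const[OF d(1) _ assms(5)])
    fix u assume u: "u \<in> set vs"
    have "(\<Sum>v\<in>set vs. a * of_bool (u = v) + b * of_bool ((u, v) \<in> parcs G)) =
        a * (\<Sum>v\<in>set vs. of_bool (u = v)) + b * (\<Sum>v\<in>set vs. of_bool ((u, v) \<in> parcs G))"
      by (simp only: sum.distrib sum_distrib_left)
    then show "(\<Sum>v\<in>set vs. a * of_bool (u = v) + b * of_bool ((u, v) \<in> parcs G)) = a + b * real r"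
      using u regular_graph_sum_adj[OF assms(1), of u, where 'b = real] by (simp add: d(2)[symmetric]) 
  qed
  also have "det (matrix_on vs (\<lambda>u v. a * of_bool (u = v) + b * of_bool ((u, v) \<in> parcs G))) =
      (\<Prod>i = 1..length vs. a + b * real r - b * real r * \<mu> i)"
    by (rule regular_graph_det_spectrum[OF assms(1,2,4)])
  also have "\<dots> = (a + b * real r) * P"
  proof -
    have "{1..length vs} = insert 1 {2..length vs}"
      using assms(3) by (cases vs) auto
    then show ?thesis
      using regular_graph_least_eigenvalue[OF assms(1-4)] by (simp add: P_def mult.assoc)
  qed
  finally have "det (matrix_on vs (\<lambda>u v. a * of_bool (u = v) + b * of_bool ((u, v) \<in> parcs G) + c)) =
      (a + b * real r) * P * (1 + of_nat (length vs) * c / (a + b * real r))" .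
  also have "\<dots> = (a + b * real r + real (length vs) * c) * P"
    using assms(5) by (simp add: field_simps)
  finally show ?thesis
    unfolding P_def .
qed

section \<open>Incidence counts and vertex degrees in the join\<close>

lemma edge_set_iff: "e \<in> edge_set G \<longleftrightarrow> (\<exists>u v. (u, v) \<in> parcs G \<and> e = {u, v})"
  by (auto simp: edge_set_def)

lemma edges_at_eq:
  assumes "pair_graph G"
  shows "{e \<in> edge_set G. u \<in> e} = (\<lambda>w. {u, w}) ` {w. (u, w) \<in> parcs G}"
  using pair_graphD(3)[OF assms] by (auto simp: edge_set_iff sym_def insert_commute)

text \<open>A diagonal entry of \<open>R R\<^sup>T\<close> and at the same time a row sum of
  \<open>R\<close>: edges at \<open>u\<close> correspond to neighbours \<open>w\<close> through
  \<open>{u, w}\<close>.\<close>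

lemma regular_graph_card_edges_at:
  assumes "regular_graph G r" and "u \<in> pverts G"
  shows "card {e \<in> edge_set G. u \<in> e} = r"
proof -
  have "pair_graph G"
    using assms(1) by (simp add: regular_graph_def)
  moreover have "inj_on (\<lambda>w. {u, w}) {w. (u, w) \<in> parcs G}"
    by (auto simp: inj_on_def doubleton_eq_iff)
  ultimately show ?thesis
    using regular_graph_card_nbrs[OF assms] by (simp add: edges_at_eq card_image)
qed

text \<open>An off-diagonal entry of \<open>R R\<^sup>T\<close>: only the edge \<open>{u, v}\<close>
  can contain two distinct vertices \<open>u\<close> and \<open>v\<close>.\<close>

lemma card_edges_at_both:
  assumes "pair_graph G" and "u \<noteq> v"
  shows "card {e \<in> edge_set G. u \<in> e \<and> v \<in> e} = of_bool ((u, v) \<in> parcs G)"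
proof -
  have "{e \<in> edge_set G. u \<in> e \<and> v \<in> e} = (if (u, v) \<in> parcs G then {{u, v}} else {})"
    using assms(2) pair_graphD(3)[OF assms(1)] by (auto simp: edge_set_iff sym_def)
  then show ?thesis by simp
qed

lemma card_edge:
  assumes "pair_graph G" and "e \<in> edge_set G"
  shows "card e = 2"
  using assms(2) pair_graphD(4)[OF assms(1)] by (auto simp: edge_set_iff irrefl_def card_insert_if)

lemma pair_graph_finite_nbrs:
  assumes "pair_graph G"
  shows "finite {w. (v, w) \<in> parcs G}"
  using pair_graphD(1,2)[OF assms] by (elim finite_subset[rotated]) auto

text \<open>One rule for each of the nine blocks of the adjacency matrix, for rewriting.\<close>

lemma central_edge_join_arcs:
  "(Inl (Inl u), Inl (Inl v)) \<in> parcs (central_edge_join G H) \<longleftrightarrow>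
     u \<in> pverts G \<and> v \<in> pverts G \<and> u \<noteq> v \<and> (u, v) \<notin> parcs G"
  "(Inl (Inl u), Inl (Inr e)) \<in> parcs (central_edge_join G H) \<longleftrightarrow> e \<in> edge_set G \<and> u \<in> e"
  "(Inl (Inr e), Inl (Inl u)) \<in> parcs (central_edge_join G H) \<longleftrightarrow> e \<in> edge_set G \<and> u \<in> e"
  "(Inl (Inr e), Inl (Inr e')) \<notin> parcs (central_edge_join G H)"
  "(Inl (Inl u), Inr w) \<notin> parcs (central_edge_join G H)"
  "(Inr w, Inl (Inl u)) \<notin> parcs (central_edge_join G H)"
  "(Inl (Inr e), Inr w) \<in> parcs (central_edge_join G H) \<longleftrightarrow> e \<in> edge_set G \<and> w \<in> pverts H"
  "(Inr w, Inl (Inr e)) \<in> parcs (central_edge_join G H) \<longleftrightarrow> e \<in> edge_set G \<and> w \<in> pverts H"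
  "(Inr w, Inr w') \<in> parcs (central_edge_join G H) \<longleftrightarrow> (w, w') \<in> parcs H"
  by (auto simp: central_edge_join_def central_graph_def)

text \<open>The \<open>r\<close> neighbours lost in the central graph are made up for by the
  \<open>r\<close> subdivision vertices on the edges at \<open>u\<close>, so \<open>r\<close>
  cancels.\<close>

lemma central_edge_join_degree_vertex:
  fixes G :: "'a pair_pre_digraph" and H :: "'b pair_pre_digraph"
  assumes "regular_graph G r" and "u \<in> pverts G"
  shows "vertex_degree (central_edge_join G H) (Inl (Inl u)) = card (pverts G) - 1"
proof -
  have pg: "pair_graph G"
    using assms(1) by (simp add: regular_graph_def)
  let ?N = "{w. (u, w) \<in> parcs G}" and ?E = "{e \<in> edge_set G. u \<in> e}"
  have N: "?N \<subseteq> pverts G - {u}"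
    using pair_graphD(2,4)[OF pg] by (auto simp: irrefl_def)
  have fin: "finite (pverts G)" "finite (edge_set G)"
    using pair_graphD(1)[OF pg] finite_edge_set[OF pg] by auto
  have "{q. (Inl (Inl u), q) \<in> parcs (central_edge_join G H)} =
      (Inl \<circ> Inr) ` ?E \<union> (Inl \<circ> Inl) ` (pverts G - {u} - ?N)"
    using assms by (auto simp: central_edge_join_def central_graph_def)
  then have "vertex_degree (central_edge_join G H) (Inl (Inl u)) =
      card ((Inl \<circ> Inr :: _ \<Rightarrow> ('a + 'a set) + 'b) ` ?E) +
      card ((Inl \<circ> Inl :: _ \<Rightarrow> ('a + 'a set) + 'b) ` (pverts G - {u} - ?N))"
    unfolding vertex_degree_eq_card using fin by (simp, subst card_Un_disjoint) auto
  also have "\<dots> = card ?E + card (pverts G - {u} - ?N)"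
    by (subst (1 2) card_image) (auto simp: inj_on_def)
  also have "card (pverts G - {u} - ?N) = card (pverts G - {u}) - card ?N"
    using N pair_graph_finite_nbrs[OF pg] by (intro card_Diff_subset)
  \<comment> \<open>The subtraction is on natural numbers; \<open>N\<close> lies within the other
    vertices, so nothing is truncated.\<close>
  also have "card ?E + (card (pverts G - {u}) - card ?N) = card (pverts G - {u})"
    using card_mono[OF _ N] fin(1)
    by (simp add: regular_graph_card_edges_at[OF assms] regular_graph_card_nbrs[OF assms])
  finally show ?thesis
    using assms(2) by simp
qed

text \<open>The summand 2 counts the ends of the subdivided edge; the rest are the join
  arcs.\<close>

lemma central_edge_join_degree_edge:
  fixes G :: "'a pair_pre_digraph" and H :: "'b pair_pre_digraph"
  assumes "pair_graph G" and "pair_graph H" and "e \<in> edge_set G"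
  shows "vertex_degree (central_edge_join G H) (Inl (Inr e)) = card (pverts H) + 2"
proof -
  have fin: "finite e" "finite (pverts H)"
    using card_edge[OF assms(1,3)] pair_graphD(1)[OF assms(2)] by (auto intro: card_ge_0_finite)
  have "{q. (Inl (Inr e), q) \<in> parcs (central_edge_join G H)} =
      (Inl \<circ> Inl) ` e \<union> Inr ` pverts H"
    using assms by (auto simp: central_edge_join_def central_graph_def)
  then have "vertex_degree (central_edge_join G H) (Inl (Inr e)) =
      card ((Inl \<circ> Inl :: _ \<Rightarrow> ('a + 'a set) + 'b) ` e) + card (Inr ` pverts H :: (('a + 'a set) + 'b) set)"
    unfolding vertex_degree_eq_card using fin by (simp, subst card_Un_disjoint) auto
  also have "\<dots> = card e + card (pverts H)"
    by (subst (1 2) card_image) (auto simp: inj_on_def)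
  finally show ?thesis
    using card_edge[OF assms(1,3)] by simp
qed

text \<open>Neighbours inside \<open>H\<close> plus all subdivision vertices. The sum is 0 when both
  graphs are edgeless, a case to be allowed for below.\<close>

lemma central_edge_join_degree_right:
  fixes G :: "'a pair_pre_digraph" and H :: "'b pair_pre_digraph"
  assumes "pair_graph G" and "regular_graph H r" and "w \<in> pverts H"
  shows "vertex_degree (central_edge_join G H) (Inr w) = r + card (edge_set G)"
proof -
  have pg: "pair_graph H"
    using assms(2) by (simp add: regular_graph_def)
  let ?N = "{v. (w, v) \<in> parcs H}"
  have fin: "finite ?N" "finite (edge_set G)"
    using pair_graph_finite_nbrs[OF pg] finite_edge_set[OF assms(1)] by auto
  have "{q. (Inr w, q) \<in> parcs (central_edge_join G H)} =
      Inr ` ?N \<union> (Inl \<circ> Inr) ` edge_set G"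
    using assms by (auto simp: central_edge_join_def central_graph_def)
  then have "vertex_degree (central_edge_join G H) (Inr w) =
      card (Inr ` ?N :: (('a + 'a set) + 'b) set) + card ((Inl \<circ> Inr :: _ \<Rightarrow> ('a + 'a set) + 'b) ` edge_set G)"
    unfolding vertex_degree_eq_card using fin by (simp, subst card_Un_disjoint) auto
  also have "\<dots> = card ?N + card (edge_set G)"
    by (subst (1 2) card_image) (auto simp: inj_on_def)
  finally show ?thesis
    by (simp add: regular_graph_card_nbrs[OF assms(2,3)])
qed

section \<open>The characteristic polynomial of the join at a generic point\<close>

text \<open>The factors come from the edge block \<open>y I\<close>, from the
  \<open>G\<^sub>1\<close> block \<open>a I + b A + J / d\<^sub>1\<close> with row sum
  \<open>\<sigma>\<close>, and from the \<open>G\<^sub>2\<close> block after both complements. The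
  quantities assumed nonzero are the divisors: \<open>y\<close> and \<open>\<sigma>\<close> in the
  two complements, \<open>a + b * r\<^sub>1\<close> and \<open>t - m / d\<^sub>3\<close> in the
  constant updates of the two graph blocks.\<close>

lemma char_poly_central_edge_join_eval:
  fixes G\<^sub>1 :: "'a pair_pre_digraph" and G\<^sub>2 :: "'b pair_pre_digraph"
    and r\<^sub>1 r\<^sub>2 n\<^sub>1 n\<^sub>2 m :: nat and t y d\<^sub>1 d\<^sub>2 d\<^sub>3 a b \<sigma> :: real
  assumes reg: "regular_graph G\<^sub>1 r\<^sub>1" "regular_graph G\<^sub>2 r\<^sub>2"
    and n: "n\<^sub>1 = card (pverts G\<^sub>1)" "n\<^sub>1 \<ge> 2" "n\<^sub>2 = card (pverts G\<^sub>2)" "n\<^sub>2 \<ge> 1"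
    and m: "m = card (edge_set G\<^sub>1)"
    and enum: "vertex_enum G\<^sub>1 vs\<^sub>1" "vertex_enum G\<^sub>2 vs\<^sub>2" "vertex_enum (central_edge_join G\<^sub>1 G\<^sub>2) vs"
    and ev: "ordered_eigenvalues (normalized_laplacian G\<^sub>1 vs\<^sub>1) \<mu>\<^sub>1"
      "ordered_eigenvalues (normalized_laplacian G\<^sub>2 vs\<^sub>2) \<mu>\<^sub>2"
    and d: "d\<^sub>1 = real n\<^sub>1 - 1" "d\<^sub>2 = real n\<^sub>2 + 2" "d\<^sub>3 = real r\<^sub>2 + real m"
    and y: "y = t - 1" "y \<noteq> 0"
    and ab: "a = y - 1 / d\<^sub>1 - real r\<^sub>1 / (d\<^sub>1 * d\<^sub>2 * y)" "b = - 1 / d\<^sub>1 - 1 / (d\<^sub>1 * d\<^sub>2 * y)"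
      "a + b * real r\<^sub>1 \<noteq> 0"
    and \<sigma>: "\<sigma> = a + b * real r\<^sub>1 + real n\<^sub>1 / d\<^sub>1" "\<sigma> \<noteq> 0"
    and t: "t - real m / d\<^sub>3 \<noteq> 0"
  shows "poly (char_poly (normalized_laplacian (central_edge_join G\<^sub>1 G\<^sub>2) vs)) t =
    y ^ m * (\<sigma> * (\<Prod>i = 2..n\<^sub>1. a + b * real r\<^sub>1 - b * real r\<^sub>1 * \<mu>\<^sub>1 i)) *
    ((t - real m / d\<^sub>3 - real n\<^sub>2 * (real m / (d\<^sub>2 * d\<^sub>3 * y) +
        real n\<^sub>1 * (real r\<^sub>1)\<^sup>2 / (d\<^sub>1 * d\<^sub>2\<^sup>2 * d\<^sub>3 * y\<^sup>2 * \<sigma>))) *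
      (\<Prod>i = 2..n\<^sub>2. t - real m / d\<^sub>3 - real r\<^sub>2 / d\<^sub>3 * \<mu>\<^sub>2 i))"
proof -
  let ?H = "central_edge_join G\<^sub>1 G\<^sub>2"
  have pg: "pair_graph G\<^sub>1" "pair_graph G\<^sub>2"
    using reg by (auto simp: regular_graph_def)
  have irr: "(u, u) \<notin> parcs G\<^sub>1" "(w, w) \<notin> parcs G\<^sub>2" for u w
    using pair_graphD(4)[OF pg(1)] pair_graphD(4)[OF pg(2)] by (auto simp: irrefl_def)
  have dist: "distinct vs\<^sub>1" "distinct vs\<^sub>2" "distinct vs"
    and sets: "set vs\<^sub>1 = pverts G\<^sub>1" "set vs\<^sub>2 = pverts G\<^sub>2" "set vs = pverts ?H"
    using enum by (auto simp: vertex_enum_def)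
  have len: "length vs\<^sub>1 = n\<^sub>1" "length vs\<^sub>2 = n\<^sub>2"
    using enum n by (simp_all add: length_vertex_enum)
  have pos: "d\<^sub>1 > 0" "d\<^sub>2 > 0" "d\<^sub>3 \<ge> 0"
    using n d by auto
  have finE: "finite (edge_set G\<^sub>1)"
    by (rule finite_edge_set[OF pg(1)])
  then obtain es where es: "distinct es" "set es = edge_set G\<^sub>1"
    using finite_distinct_list by blast
  have len_es: "length es = m"
    using es m distinct_card by fastforce
  have deg: "u \<in> pverts G\<^sub>1 \<Longrightarrow> real (vertex_degree ?H (Inl (Inl u))) = d\<^sub>1"
    "e \<in> edge_set G\<^sub>1 \<Longrightarrow> real (vertex_degree ?H (Inl (Inr e))) = d\<^sub>2"
    "w \<in> pverts G\<^sub>2 \<Longrightarrow> real (vertex_degree ?H (Inr w)) = d\<^sub>3" for u e w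
    using central_edge_join_degree_vertex[OF reg(1), where H = G\<^sub>2] central_edge_join_degree_edge[OF pg]
      central_edge_join_degree_right[OF pg(1) reg(2)] n m d by (auto simp: of_nat_diff)
  \<comment> \<open>The entries of \<open>t I - L\<close> for the join. In the names of the block
    facts below, \<open>v\<close> stands for a vertex of \<open>G\<^sub>1\<close>, \<open>e\<close>
    for an edge of \<open>G\<^sub>1\<close> and \<open>w\<close> for a vertex of
    \<open>G\<^sub>2\<close>.\<close>
  define F where "F p q = t * of_bool (p = q) -
      (if p = q \<and> vertex_degree ?H p \<noteq> 0 then 1
       else if (p, q) \<in> parcs ?H then - 1 / sqrt (real (vertex_degree ?H p) * real (vertex_degree ?H q))
       else 0)" for p q
  \<comment> \<open>This is \<open>y\<close> unless \<open>d\<^sub>3 = 0\<close>; then the vertices of \<open>G\<^sub>2\<close> are isolated and have diagonal entry \<open>t\<close>,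
    which \<open>z\<close> equals because division by \<open>0\<close> yields \<open>0\<close>.\<close>
  define z where "z = t - real m / d\<^sub>3 - real r\<^sub>2 / d\<^sub>3"
  have deg_nz: "u \<in> pverts G\<^sub>1 \<Longrightarrow> vertex_degree ?H (Inl (Inl u)) \<noteq> 0"
    "e \<in> edge_set G\<^sub>1 \<Longrightarrow> vertex_degree ?H (Inl (Inr e)) \<noteq> 0"
    "w \<in> pverts G\<^sub>2 \<Longrightarrow> vertex_degree ?H (Inr w) = 0 \<longleftrightarrow> d\<^sub>3 = 0" for u e w
    using deg(1)[of u] deg(2)[of e] deg(3)[of w] pos by auto
  have z_eq: "z = (if d\<^sub>3 = 0 then t else y)"
  proof (cases "d\<^sub>3 = 0")
    case False
    then have "real m / d\<^sub>3 + real r\<^sub>2 / d\<^sub>3 = 1"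
      by (simp add: d(3) flip: add_divide_distrib)
    with False show ?thesis
      by (simp add: z_def y(1))
  qed (simp add: z_def)
  have F_vv: "F (Inl (Inl u)) (Inl (Inl v)) =
      y * of_bool (u = v) + (1 - of_bool (u = v) - of_bool ((u, v) \<in> parcs G\<^sub>1)) / d\<^sub>1"
    if "u \<in> pverts G\<^sub>1" "v \<in> pverts G\<^sub>1" for u v
    using that pos irr by (auto simp: F_def deg deg_nz central_edge_join_arcs y(1))
  have F_ve: "F (Inl (Inl u)) (Inl (Inr e)) = of_bool (u \<in> e) / sqrt (d\<^sub>1 * d\<^sub>2)"
    if "u \<in> pverts G\<^sub>1" "e \<in> edge_set G\<^sub>1" for u e
    using that by (auto simp: F_def deg central_edge_join_arcs)
  have F_ev: "F (Inl (Inr e)) (Inl (Inl u)) = of_bool (u \<in> e) / sqrt (d\<^sub>1 * d\<^sub>2)"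
    if "u \<in> pverts G\<^sub>1" "e \<in> edge_set G\<^sub>1" for u e
    using that by (auto simp: F_def deg central_edge_join_arcs mult.commute)
  have F_ee: "F (Inl (Inr e)) (Inl (Inr e')) = y * of_bool (e = e')"
    if "e \<in> edge_set G\<^sub>1" "e' \<in> edge_set G\<^sub>1" for e e'
    using that by (auto simp: F_def deg_nz central_edge_join_arcs y(1))
  have F_ew: "F (Inl (Inr e)) (Inr w) = 1 / sqrt (d\<^sub>2 * d\<^sub>3)"
    if "e \<in> edge_set G\<^sub>1" "w \<in> pverts G\<^sub>2" for e w
    using that by (auto simp: F_def deg central_edge_join_arcs)
  have F_we: "F (Inr w) (Inl (Inr e)) = 1 / sqrt (d\<^sub>2 * d\<^sub>3)"
    if "e \<in> edge_set G\<^sub>1" "w \<in> pverts G\<^sub>2" for e w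
    using that by (auto simp: F_def deg central_edge_join_arcs mult.commute)
  have F_vw: "F (Inl (Inl u)) (Inr w) = 0" and F_wv: "F (Inr w) (Inl (Inl u)) = 0" for u w
    by (simp_all add: F_def central_edge_join_arcs)
  have F_ww: "F (Inr w) (Inr w') = z * of_bool (w = w') + of_bool ((w, w') \<in> parcs G\<^sub>2) / d\<^sub>3"
    if "w \<in> pverts G\<^sub>2" "w' \<in> pverts G\<^sub>2" for w w'
    using that pos irr by (auto simp: F_def deg deg_nz central_edge_join_arcs z_eq y(1))

  define us where "us = map (Inl \<circ> Inr :: _ \<Rightarrow> ('a + 'a set) + 'b) es"
  define V where "V = map (Inl \<circ> Inl :: _ \<Rightarrow> ('a + 'a set) + 'b) vs\<^sub>1"
  define W where "W = map (Inr :: _ \<Rightarrow> ('a + 'a set) + 'b) vs\<^sub>2"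
  have dist': "distinct us" "distinct V" "distinct W"
    using dist es by (auto simp: us_def V_def W_def distinct_map inj_on_def)
  have sum_us: "(\<Sum>q\<in>set us. h q) = (\<Sum>e\<in>edge_set G\<^sub>1. h (Inl (Inr e)))" for h :: "_ \<Rightarrow> real"
    by (simp add: us_def es sum.reindex inj_on_def)
  have sum_V: "(\<Sum>q\<in>set V. h q) = (\<Sum>u\<in>pverts G\<^sub>1. h (Inl (Inl u)))" for h :: "_ \<Rightarrow> real"
    by (simp add: V_def sets sum.reindex inj_on_def)
  \<comment> \<open>The Schur complement of the edge block; as that block is \<open>y I\<close>,
    solving its linear system is division by \<open>y\<close>.\<close>
  define K where "K p q = F p q - (\<Sum>e\<in>set us. F p e * (F e q / y))" for p q
  have "poly (char_poly (normalized_laplacian ?H vs)) t = det (matrix_on vs F)"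
    by (simp only: normalized_laplacian_eq_matrix_on[OF dist(3)] poly_char_poly_matrix_on[OF dist(3)]
        F_def[abs_def])
  also have "\<dots> = det (matrix_on (us @ (V @ W)) F)"
    using dist dist' sets es
    by (intro det_matrix_on_enum)
       (auto simp: us_def V_def W_def central_edge_join_def central_graph_def)
  also have "\<dots> = det (matrix_on us F) * det (matrix_on (V @ W) K)"
    unfolding K_def
  proof (rule det_matrix_on_append[OF dist'(1)])
    fix p q assume "p \<in> set us"
    then obtain e where e: "e \<in> edge_set G\<^sub>1" "p = Inl (Inr e)"
      by (auto simp: us_def es)
    then have "(\<Sum>v\<in>set us. F p v * (F v q / y)) = (\<Sum>e'\<in>edge_set G\<^sub>1. of_bool (e = e') * F (Inl (Inr e')) q)"
      using y(2) by (auto simp: sum_us F_ee intro!: sum.cong)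
    also have "\<dots> = F p q"
      using e finE by simp
    finally show "(\<Sum>v\<in>set us. F p v * (F v q / y)) = F p q" .
  qed
  also have "det (matrix_on us F) = y ^ m"
  proof -
    have "matrix_on us F = matrix_on us (\<lambda>p q. y * of_bool (p = q))"
      by (intro matrix_on_cong) (auto simp: us_def es F_ee)
    then show ?thesis
      using det_matrix_on_diag[OF dist'(1)] by (simp add: us_def len_es)
  qed
  also have "det (matrix_on (V @ W) K) = (\<sigma> * (\<Prod>i = 2..n\<^sub>1. a + b * real r\<^sub>1 - b * real r\<^sub>1 * \<mu>\<^sub>1 i)) *
    ((t - real m / d\<^sub>3 - real n\<^sub>2 * (real m / (d\<^sub>2 * d\<^sub>3 * y) +
        real n\<^sub>1 * (real r\<^sub>1)\<^sup>2 / (d\<^sub>1 * d\<^sub>2\<^sup>2 * d\<^sub>3 * y\<^sup>2 * \<sigma>))) *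
      (\<Prod>i = 2..n\<^sub>2. t - real m / d\<^sub>3 - real r\<^sub>2 / d\<^sub>3 * \<mu>\<^sub>2 i))"
  proof -
    \<comment> \<open>The total constant subtracted from the \<open>G\<^sub>2\<close> block: the
      first summand stems from eliminating the edges, the second is
      \<open>n\<^sub>1 * c * c / \<sigma>\<close> from eliminating \<open>G\<^sub>1\<close>.\<close>
    define M where "M = real m / (d\<^sub>2 * d\<^sub>3 * y) +
        real n\<^sub>1 * (real r\<^sub>1)\<^sup>2 / (d\<^sub>1 * d\<^sub>2\<^sup>2 * d\<^sub>3 * y\<^sup>2 * \<sigma>)"
    \<comment> \<open>The constant entry of the off-diagonal blocks of \<open>K\<close>: each of the
      \<open>r\<^sub>1\<close> edges at a vertex contributes equally.\<close>
    define c where "c = - (real r\<^sub>1 / (sqrt (d\<^sub>1 * d\<^sub>2) * sqrt (d\<^sub>2 * d\<^sub>3) * y))"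
    have sq: "sqrt (d\<^sub>1 * d\<^sub>2) * sqrt (d\<^sub>1 * d\<^sub>2) = d\<^sub>1 * d\<^sub>2" "sqrt (d\<^sub>2 * d\<^sub>3) * sqrt (d\<^sub>2 * d\<^sub>3) = d\<^sub>2 * d\<^sub>3"
      using pos by simp_all
    \<comment> \<open>Only the square of \<open>c\<close> enters the second complement, so the
      square roots disappear.\<close>
    have c2: "c * c = (real r\<^sub>1)\<^sup>2 / (d\<^sub>1 * d\<^sub>2\<^sup>2 * d\<^sub>3 * y\<^sup>2)"
    proof -
      have "c * c = (real r\<^sub>1)\<^sup>2 / ((sqrt (d\<^sub>1 * d\<^sub>2) * sqrt (d\<^sub>1 * d\<^sub>2)) * (sqrt (d\<^sub>2 * d\<^sub>3) * sqrt (d\<^sub>2 * d\<^sub>3)) * y\<^sup>2)"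
        unfolding c_def power2_eq_square minus_mult_minus times_divide_times_eq by (simp only: ac_simps)
      then show ?thesis
        unfolding sq by (simp add: power2_eq_square mult.assoc mult.left_commute)
    qed
    \<comment> \<open>The eliminated term is
      \<open>R R\<^sup>T / (d\<^sub>1 * d\<^sub>2 * y)\<close> with
      \<open>R R\<^sup>T = A + r\<^sub>1 I\<close>. The remaining parts of \<open>a\<close> and
      \<open>b\<close>, and \<open>J / d\<^sub>1\<close>, come from \<open>y I\<close> and the
      complement adjacency matrix \<open>J - I - A\<close>.\<close>
    have K_vv: "K (Inl (Inl u)) (Inl (Inl v)) = a * of_bool (u = v) + b * of_bool ((u, v) \<in> parcs G\<^sub>1) + 1 / d\<^sub>1"
      if "u \<in> pverts G\<^sub>1" "v \<in> pverts G\<^sub>1" for u v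
    proof -
      have "(\<Sum>e\<in>set us. F (Inl (Inl u)) e * (F e (Inl (Inl v)) / y)) =
          (\<Sum>e\<in>edge_set G\<^sub>1. of_bool (u \<in> e \<and> v \<in> e) / (d\<^sub>1 * d\<^sub>2 * y))"
        using that sq(1) by (auto simp: sum_us F_ve F_ev intro!: sum.cong)
      also have "\<dots> = real (card {e \<in> edge_set G\<^sub>1. u \<in> e \<and> v \<in> e}) / (d\<^sub>1 * d\<^sub>2 * y)"
        using finE by (simp add: Collect_conj_eq Int_commute flip: sum_divide_distrib)
      also have "real (card {e \<in> edge_set G\<^sub>1. u \<in> e \<and> v \<in> e}) =
          real r\<^sub>1 * of_bool (u = v) + of_bool ((u, v) \<in> parcs G\<^sub>1)"
        using regular_graph_card_edges_at[OF reg(1) that(1)] card_edges_at_both[OF pg(1), of u v] irr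
        by (cases "u = v") auto
      finally show ?thesis
        using that by (simp add: K_def F_vv ab add_divide_distrib diff_divide_distrib algebra_simps)
    qed
    have K_vw: "K (Inl (Inl u)) (Inr w) = c" and K_wv: "K (Inr w) (Inl (Inl u)) = c"
      if "u \<in> pverts G\<^sub>1" "w \<in> pverts G\<^sub>2" for u w
    proof -
      have "(\<Sum>e\<in>edge_set G\<^sub>1. of_bool (u \<in> e) / (sqrt (d\<^sub>1 * d\<^sub>2) * sqrt (d\<^sub>2 * d\<^sub>3) * y)) =
          real (card {e \<in> edge_set G\<^sub>1. u \<in> e}) / (sqrt (d\<^sub>1 * d\<^sub>2) * sqrt (d\<^sub>2 * d\<^sub>3) * y)"
        using finE by (simp add: Collect_conj_eq Int_commute flip: sum_divide_distrib)
      then have s: "(\<Sum>e\<in>edge_set G\<^sub>1. of_bool (u \<in> e) / (sqrt (d\<^sub>1 * d\<^sub>2) * sqrt (d\<^sub>2 * d\<^sub>3) * y)) = - c"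
        using regular_graph_card_edges_at[OF reg(1) that(1)] by (simp add: c_def)
      have "(\<Sum>e\<in>set us. F (Inl (Inl u)) e * (F e (Inr w) / y)) = - c"
        unfolding sum_us s[symmetric] using that by (intro sum.cong) (auto simp: F_ve F_ew)
      then show "K (Inl (Inl u)) (Inr w) = c"
        by (simp add: K_def F_vw)
      have "(\<Sum>e\<in>set us. F (Inr w) e * (F e (Inl (Inl u)) / y)) = - c"
        unfolding sum_us s[symmetric] using that by (intro sum.cong) (auto simp: F_we F_ev mult.commute)
      then show "K (Inr w) (Inl (Inl u)) = c"
        by (simp add: K_def F_wv)
    qed
    have K_ww: "K (Inr w) (Inr w') =
        z * of_bool (w = w') + of_bool ((w, w') \<in> parcs G\<^sub>2) / d\<^sub>3 - real m / (d\<^sub>2 * d\<^sub>3 * y)"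
      if "w \<in> pverts G\<^sub>2" "w' \<in> pverts G\<^sub>2" for w w'
    proof -
      have "(\<Sum>e\<in>set us. F (Inr w) e * (F e (Inr w') / y)) = (\<Sum>e\<in>edge_set G\<^sub>1. 1 / (d\<^sub>2 * d\<^sub>3 * y))"
        unfolding sum_us using that sq(2) by (intro sum.cong) (auto simp: F_ew F_we)
      then show ?thesis
        using that by (simp add: K_def F_ww m)
    qed
    \<comment> \<open>Second elimination: the \<open>G\<^sub>1\<close> block has constant row sum
      \<open>\<sigma>\<close> and both off-diagonal blocks have constant entry
      \<open>c\<close>.\<close>
    have "det (matrix_on (V @ W) K) =
        det (matrix_on V K) * det (matrix_on W (\<lambda>p q. K p q - of_nat (length V) * c * c / \<sigma>))"
    proof (rule det_matrix_on_append_const[OF dist'(2)])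
      fix p assume "p \<in> set V"
      then obtain u where u: "u \<in> pverts G\<^sub>1" "p = Inl (Inl u)"
        by (auto simp: V_def sets)
      then have "(\<Sum>q\<in>set V. K p q) =
          a * (\<Sum>v\<in>pverts G\<^sub>1. of_bool (u = v)) + b * (\<Sum>v\<in>pverts G\<^sub>1. of_bool ((u, v) \<in> parcs G\<^sub>1)) +
          real n\<^sub>1 / d\<^sub>1"
        by (simp add: sum_V K_vv sum.distrib sum_distrib_left n(1))
      also have "(\<Sum>v\<in>pverts G\<^sub>1. of_bool (u = v)) = (1 :: real)"
        using u by (simp flip: sets)
      finally show "(\<Sum>q\<in>set V. K p q) = \<sigma>"
        using u by (simp add: \<sigma>(1) regular_graph_sum_adj[OF reg(1)])
    qed (use \<sigma>(2) K_vw K_wv in \<open>auto simp: V_def W_def sets\<close>)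
    also have "matrix_on V K =
        matrix_on vs\<^sub>1 (\<lambda>u v. a * of_bool (u = v) + b * of_bool ((u, v) \<in> parcs G\<^sub>1) + 1 / d\<^sub>1)"
      unfolding V_def matrix_on_map by (intro matrix_on_cong) (simp add: K_vv sets)
    also have "det \<dots> = \<sigma> * (\<Prod>i = 2..n\<^sub>1. a + b * real r\<^sub>1 - b * real r\<^sub>1 * \<mu>\<^sub>1 i)"
      using n len by (subst regular_graph_det_spectrum_add_const[OF reg(1) enum(1) _ ev(1) ab(3)]) (auto simp: \<sigma>(1))
    also have "matrix_on W (\<lambda>p q. K p q - of_nat (length V) * c * c / \<sigma>) =
        matrix_on vs\<^sub>2 (\<lambda>u v. z * of_bool (u = v) + 1 / d\<^sub>3 * of_bool ((u, v) \<in> parcs G\<^sub>2) +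
          - M)"
      unfolding W_def matrix_on_map
      by (intro matrix_on_cong) (simp add: K_ww sets V_def len mult.assoc c2 M_def)
    also have "det \<dots> = (t - real m / d\<^sub>3 - real n\<^sub>2 * M) *
      (\<Prod>i = 2..n\<^sub>2. t - real m / d\<^sub>3 - real r\<^sub>2 / d\<^sub>3 * \<mu>\<^sub>2 i)"
    proof -
      \<comment> \<open>The row sum of \<open>z I + A / d\<^sub>3\<close>; the definition of
        \<open>z\<close> makes it uniform, including \<open>d\<^sub>3 = 0\<close>.\<close>
      have 1: "z + 1 / d\<^sub>3 * real r\<^sub>2 = t - real m / d\<^sub>3"
        by (simp add: z_def)
      have 2: "1 / d\<^sub>3 * real r\<^sub>2 * k = real r\<^sub>2 / d\<^sub>3 * k" for k
        by simp
      have "vs\<^sub>2 \<noteq> []"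
        using n len by auto
      from regular_graph_det_spectrum_add_const[OF reg(2) enum(2) this ev(2), of z "1 / d\<^sub>3" "- M",
          unfolded 1 2 len, OF t]
      show ?thesis
        by simp
    qed
    finally show ?thesis
      unfolding M_def .
  qed
  finally show ?thesis
    by (simp only: mult.assoc)
qed

section \<open>From values at points to an identity of rational functions\<close>

lemma to_fract_power: "to_fract (p ^ n) = to_fract p ^ n"
  by (induction n) simp_all

text \<open>The exponent may be negative, so the formula lives in the fraction field;
  cross-multiplying reduces it to an identity of polynomials.\<close>

lemma to_fract_eq_powi_mult:
  assumes "q \<noteq> 0" and "p * q ^ (n + 1) = q ^ m * r"
  shows "to_fract p = to_fract q powi (int m - int n - 1) * to_fract r"
proof -
  have nz: "to_fract q \<noteq> 0"
    using assms(1) by simp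
  have "to_fract p * to_fract q ^ (n + 1) = to_fract q ^ m * to_fract r"
    unfolding to_fract_power[symmetric] to_fract_mult[symmetric] assms(2) ..
  then have "to_fract p = to_fract q ^ m * to_fract r / to_fract q ^ (n + 1)"
    using nz by (metis nonzero_mult_div_cancel_right power_not_zero)
  also have "\<dots> = to_fract q ^ m / to_fract q ^ (n + 1) * to_fract r"
    by (rule times_divide_eq_left[symmetric])
  also have "to_fract q ^ m / to_fract q ^ (n + 1) = to_fract q powi (int m - int (n + 1))"
    by (simp only: power_int_diff[OF disjI1[OF nz]] power_int_of_nat)
  also have "int m - int (n + 1) = int m - int n - 1"
    by simp
  finally show ?thesis .
qed

text \<open>The product \<open>r * (p - q)\<close> vanishes at every point, also at the roots of
  \<open>r\<close>, and is therefore the zero polynomial; the nonzero \<open>r\<close>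
  cancels.\<close>

lemma poly_eqI_nonroots:
  fixes p q r :: "'a :: {idom, ring_char_0} poly"
  assumes "r \<noteq> 0" and "\<And>t. poly r t \<noteq> 0 \<Longrightarrow> poly p t = poly q t"
  shows "p = q"
proof -
  have "poly (r * (p - q)) t = 0" for t
    using assms(2)[of t] by auto
  then have "r * (p - q) = 0"
    using poly_all_0_iff_0 by blast
  with assms(1) show ?thesis by simp
qed

theorem theorem4p3:
  fixes G\<^sub>1 :: "'a pair_pre_digraph" and G\<^sub>2 :: "'b pair_pre_digraph"
    and r\<^sub>1 r\<^sub>2 n\<^sub>1 n\<^sub>2 m\<^sub>1 :: nat
    and \<mu>\<^sub>1 \<mu>\<^sub>2 :: "nat \<Rightarrow> real"
    and x :: "real poly"
  assumes "regular_graph G\<^sub>1 r\<^sub>1" and "regular_graph G\<^sub>2 r\<^sub>2"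
    and "n\<^sub>1 = card (pverts G\<^sub>1)" and "n\<^sub>1 \<ge> 2"
    and "n\<^sub>2 = card (pverts G\<^sub>2)" and "n\<^sub>2 \<ge> 2"
    and "m\<^sub>1 = card (edge_set G\<^sub>1)"
    and "vertex_enum G\<^sub>1 vs\<^sub>1" and "ordered_eigenvalues (normalized_laplacian G\<^sub>1 vs\<^sub>1) \<mu>\<^sub>1"
    and "vertex_enum G\<^sub>2 vs\<^sub>2" and "ordered_eigenvalues (normalized_laplacian G\<^sub>2 vs\<^sub>2) \<mu>\<^sub>2"
    and "vertex_enum (central_edge_join G\<^sub>1 G\<^sub>2) vs"
    and "x = [:0, 1:]"
  shows "to_fract (char_poly (normalized_laplacian (central_edge_join G\<^sub>1 G\<^sub>2) vs)) =
    to_fract (x - 1) powi (int m\<^sub>1 - int n\<^sub>1 - 1) *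
    to_fract (
      (\<Prod>i = 2..n\<^sub>2. x - [:real m\<^sub>1 / (real r\<^sub>2 + real m\<^sub>1):]
                      - [:real r\<^sub>2 / (real r\<^sub>2 + real m\<^sub>1) * \<mu>\<^sub>2 i:]) *
      (\<Prod>i = 2..n\<^sub>1. (x - 1)\<^sup>2
                      + [:(- 1 - real r\<^sub>1 + real r\<^sub>1 * \<mu>\<^sub>1 i) / (real n\<^sub>1 - 1):] * (x - 1)
                      - [:(2 * real r\<^sub>1 - real r\<^sub>1 * \<mu>\<^sub>1 i) / ((real n\<^sub>1 - 1) * (real n\<^sub>2 + 2)):]) *
      (((x - 1)\<^sup>2 + [:(real n\<^sub>1 - 1 - real r\<^sub>1) / (real n\<^sub>1 - 1):] * (x - 1)
          - [:2 * real r\<^sub>1 / ((real n\<^sub>1 - 1) * (real n\<^sub>2 + 2)):]) *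
       ((x - [:real m\<^sub>1 / (real r\<^sub>2 + real m\<^sub>1):]) * (x - 1)
          - [:real n\<^sub>2 * real m\<^sub>1 / ((real n\<^sub>2 + 2) * (real r\<^sub>2 + real m\<^sub>1)):])
       - [:real n\<^sub>2 * (real r\<^sub>1)\<^sup>2 * real n\<^sub>1
            / ((real n\<^sub>1 - 1) * (real n\<^sub>2 + 2)\<^sup>2 * (real r\<^sub>2 + real m\<^sub>1)):]))"
    (is "to_fract ?P = _ * to_fract ?R")
proof -
  define d\<^sub>1 d\<^sub>2 d\<^sub>3 where d: "d\<^sub>1 = real n\<^sub>1 - 1" "d\<^sub>2 = real n\<^sub>2 + 2" "d\<^sub>3 = real r\<^sub>2 + real m\<^sub>1"
  have pos: "d\<^sub>1 > 0" "d\<^sub>2 > 0"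
    using assms(4) d by auto
  have poly_x: "poly x t = t" for t
    by (simp add: assms(13))
  \<comment> \<open>The common shape of the quadratic factors; it is monic in \<open>x\<close>,
    hence nonzero.\<close>
  define quad where "quad k e = (x - 1)\<^sup>2 + [:k:] * (x - 1) - [:e:]" for k e
  have poly_quad: "poly (quad k e) t = (t - 1)\<^sup>2 + k * (t - 1) - e" for k e t
    by (simp add: quad_def poly_x)
  have quad_nz: "quad k e \<noteq> 0" for k e
    by (simp add: quad_def assms(13) power2_eq_square one_pCons)
  \<comment> \<open>At \<open>t\<close> these become \<open>y * (a + b * r\<^sub>1)\<close> and
    \<open>y * \<sigma>\<close>: \<open>q\<close> is the quadratic factor for eigenvalue 0, and
    \<open>s\<close> the one in the last bracket.\<close>
  define q s where "q = quad ((- 1 - real r\<^sub>1) / d\<^sub>1) (2 * real r\<^sub>1 / (d\<^sub>1 * d\<^sub>2))"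
    and "s = quad ((d\<^sub>1 - real r\<^sub>1) / d\<^sub>1) (2 * real r\<^sub>1 / (d\<^sub>1 * d\<^sub>2))"
  \<comment> \<open>Its roots are the points where a divisor of the pointwise formula vanishes, or
    where \<open>y = 0\<close>.\<close>
  define bad where "bad = (x - 1) * (x - [:real m\<^sub>1 / d\<^sub>3:]) * q * s"
  have bad_nz: "bad \<noteq> 0"
  proof -
    have "x - [:c:] \<noteq> 0" for c
      by (simp add: assms(13))
    from this[of 1] this[of "real m\<^sub>1 / d\<^sub>3"] quad_nz show ?thesis
      unfolding bad_def q_def s_def one_pCons by (simp only: mult_eq_0_iff simp_thms not_False_eq_True)
  qed
  define R where "R = ?R"
  have R_eq: "R = (\<Prod>i = 2..n\<^sub>2. x - [:real m\<^sub>1 / d\<^sub>3:] - [:real r\<^sub>2 / d\<^sub>3 * \<mu>\<^sub>2 i:]) *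
      (\<Prod>i = 2..n\<^sub>1. quad ((- 1 - real r\<^sub>1 + real r\<^sub>1 * \<mu>\<^sub>1 i) / d\<^sub>1)
        ((2 * real r\<^sub>1 - real r\<^sub>1 * \<mu>\<^sub>1 i) / (d\<^sub>1 * d\<^sub>2))) *
      (s * ((x - [:real m\<^sub>1 / d\<^sub>3:]) * (x - 1) - [:real n\<^sub>2 * real m\<^sub>1 / (d\<^sub>2 * d\<^sub>3):])
        - [:real n\<^sub>2 * (real r\<^sub>1)\<^sup>2 * real n\<^sub>1 / (d\<^sub>1 * d\<^sub>2\<^sup>2 * d\<^sub>3):])"
    by (simp only: R_def quad_def s_def d)
  have eval: "poly ?P t * (t - 1) ^ (n\<^sub>1 + 1) = (t - 1) ^ m\<^sub>1 * poly R t" if "poly bad t \<noteq> 0" for t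
  proof -
    define y where "y = t - 1"
    define a b where "a = y - 1 / d\<^sub>1 - real r\<^sub>1 / (d\<^sub>1 * d\<^sub>2 * y)" and "b = - 1 / d\<^sub>1 - 1 / (d\<^sub>1 * d\<^sub>2 * y)"
    define \<sigma> where "\<sigma> = a + b * real r\<^sub>1 + real n\<^sub>1 / d\<^sub>1"
    have nz: "y \<noteq> 0" "t - real m\<^sub>1 / d\<^sub>3 \<noteq> 0" "poly q t \<noteq> 0" "poly s t \<noteq> 0"
      using that by (auto simp: bad_def poly_x y_def)
    \<comment> \<open>Multiplication by \<open>y\<close> clears the \<open>y\<close> in the
      denominators of \<open>a\<close> and \<open>b\<close>, which turns each linear factor into a
      quadratic one.\<close>
    have quad_eq: "poly (quad ((- 1 - real r\<^sub>1 + real r\<^sub>1 * \<mu>) / d\<^sub>1)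
        ((2 * real r\<^sub>1 - real r\<^sub>1 * \<mu>) / (d\<^sub>1 * d\<^sub>2))) t = y * (a + b * real r\<^sub>1 - b * real r\<^sub>1 * \<mu>)" for \<mu>
      using pos nz(1) unfolding poly_quad y_def[symmetric]
      by (simp add: a_def b_def field_simps power2_eq_square)
    have q: "poly q t = y * (a + b * real r\<^sub>1)"
      using quad_eq[of 0] by (simp add: q_def)
    have s: "poly s t = y * \<sigma>"
    proof -
      \<comment> \<open>This turns the term \<open>n\<^sub>1 / d\<^sub>1\<close> of
        \<open>\<sigma>\<close> into \<open>1 + 1 / d\<^sub>1\<close>, whose last summand cancels
        the \<open>- 1 / d\<^sub>1\<close> in \<open>a\<close>.\<close>
      have "real n\<^sub>1 = d\<^sub>1 + 1"
        by (simp add: d(1))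
      then show ?thesis
        using pos nz(1) unfolding s_def poly_quad y_def[symmetric]
        by (simp add: a_def b_def \<sigma>_def field_simps power2_eq_square)
    qed
    have \<sigma>: "\<sigma> \<noteq> 0" and ab: "a + b * real r\<^sub>1 \<noteq> 0"
      using nz q s by auto
    define A where "A = (\<Prod>i = 2..n\<^sub>1. a + b * real r\<^sub>1 - b * real r\<^sub>1 * \<mu>\<^sub>1 i)"
    define B where "B = (\<Prod>i = 2..n\<^sub>2. t - real m\<^sub>1 / d\<^sub>3 - real r\<^sub>2 / d\<^sub>3 * \<mu>\<^sub>2 i)"
    define D where "D = t - real m\<^sub>1 / d\<^sub>3 - real n\<^sub>2 * (real m\<^sub>1 / (d\<^sub>2 * d\<^sub>3 * y) +
        real n\<^sub>1 * (real r\<^sub>1)\<^sup>2 / (d\<^sub>1 * d\<^sub>2\<^sup>2 * d\<^sub>3 * y\<^sup>2 * \<sigma>))"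
    have P: "poly ?P t = y ^ m\<^sub>1 * (\<sigma> * A) * (D * B)"
      unfolding A_def B_def D_def
      by (rule char_poly_central_edge_join_eval[OF assms(1-5) _ assms(7,8,10,12,9,11) d y_def nz(1)
            a_def b_def ab \<sigma>_def \<sigma> nz(2)]) (use assms(6) in simp)
    \<comment> \<open>\<open>D\<close> is the all-ones factor of the \<open>G\<^sub>2\<close> block,
      and \<open>y\<^sup>2 * \<sigma>\<close> clears \<open>y\<close> and \<open>\<sigma>\<close>
      from its denominators. If \<open>d\<^sub>3 = 0\<close>, quotients by it are 0 and both sides
      are \<open>y\<^sup>2 * \<sigma> * t\<close>, hence the case split.\<close>
    have last: "y * \<sigma> * ((t - real m\<^sub>1 / d\<^sub>3) * y - real n\<^sub>2 * real m\<^sub>1 / (d\<^sub>2 * d\<^sub>3))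
        - real n\<^sub>2 * (real r\<^sub>1)\<^sup>2 * real n\<^sub>1 / (d\<^sub>1 * d\<^sub>2\<^sup>2 * d\<^sub>3) = y\<^sup>2 * \<sigma> * D"
      using pos nz(1) \<sigma> unfolding D_def
      by (cases "d\<^sub>3 = 0") (simp_all add: field_simps power2_eq_square)
    have "poly R t = B * (y ^ (n\<^sub>1 - 1) * A) * (y\<^sup>2 * \<sigma> * D)"
      unfolding R_eq last[symmetric]
      by (simp add: poly_prod quad_eq s poly_x prod.distrib A_def B_def flip: y_def)
    \<comment> \<open>Of the powers of \<open>y\<close>, \<open>n\<^sub>1 - 1\<close> come from the
      quadratic factors of \<open>G\<^sub>1\<close> and two from the last bracket.\<close>
    moreover have "y ^ (n\<^sub>1 + 1) = y ^ (n\<^sub>1 - 1) * y\<^sup>2"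
      using assms(4) by (simp flip: power_add)
    ultimately show ?thesis
      unfolding P y_def[symmetric] by simp
  qed
  have "?P * (x - 1) ^ (n\<^sub>1 + 1) = (x - 1) ^ m\<^sub>1 * R"
  proof (rule poly_eqI_nonroots[OF bad_nz])
    fix t assume "poly bad t \<noteq> 0"
    from eval[OF this] show "poly (?P * (x - 1) ^ (n\<^sub>1 + 1)) t = poly ((x - 1) ^ m\<^sub>1 * R) t"
      by (simp only: poly_mult poly_power poly_diff poly_x poly_1)
  qed
  moreover have "x - 1 \<noteq> 0"
    by (simp add: assms(13) one_pCons)
  ultimately show ?thesis
    unfolding R_def by (rule to_fract_eq_powi_mult[rotated])
qed

end
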